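(* Let $n>p$ be positive integers, let $M\in\mathbb{R}^{n\times p}$ and $X\in\mathrm{St}(n,p)$, and assume $\mathcal{P}_X(M)\ne 0$. Let $B_*$ be an optimal solution of the Stiefel Muon problem $$\min_{B}\ \langle M,B\rangle\quad\text{subject to}\quad \|B\|_2\le 1,\quad B\in T_X\mathrm{St}(n,p).$$ Then there exists a skew-symmetric matrix $Y_*\in\mathcal{A}^n$ that is an optimal solution of the Skewon problem $$\min_{Y\in\mathbb{R}^{n\times n}}\ \langle \operatorname{skew}(MX^\top),Y\rangle\quad\text{subject to}\quad \|Y\|_2\le 1,$$ such that $Y_*X=B_*$ and $\|Y_*\|_2=\|B_*\|_2=1$, and both problems achieve identical minimum objective values.
   Context: $\mathrm{St}(n,p)=\{X\in\mathbb{R}^{n\times p}: X^\top X=I_p\}$ with $n>p$ is the Stiefel manifold, with tangent space $T_X\mathrm{St}(n,p)=\{B\in\mathbb{R}^{n\times p}: X^\top B+B^\top X=0\}$ at $X\in\mathrm{St}(n,p)$. $\langle A,B\rangle=\operatorname{tr}(A^\top B)$ is the Frobenius inner product and $\|\cdot\|_2$ is the matrix spectral norm. $\mathcal{A}^n$ is the space of real skew-symmetric $n\times n$ matrices. For a square matrix $A$, $\operatorname{sym}(A)=\frac12(A+A^\top)$ and $\operatorname{skew}(A)=\frac12(A-A^\top)$. The orthogonal projection onto $T_X\mathrm{St}(n,p)$ is $\mathcal{P}_X(G)=G-X\operatorname{sym}(X^\top G)$ for $G\in\mathbb{R}^{n\times p}$. *)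

theory Defs
  imports "HOL-Analysis.Analysis"
begin

text \<open>An \<open>n \<times> p\<close> real matrix has type \<open>real^'p^'n\<close> (rows indexed by \<open>'n\<close>).\<close>

definition frob_inner :: "real^'p^'n \<Rightarrow> real^'p^'n \<Rightarrow> real" where
  "frob_inner A B = trace (transpose A ** B)"

text \<open>The spectral norm is the operator norm with respect to the Euclidean vector norms.\<close>

definition spectral_norm :: "real^'p^'n \<Rightarrow> real" where
  "spectral_norm A = onorm (\<lambda>v. A *v v)"

definition sym_part :: "real^'n^'n \<Rightarrow> real^'n^'n" where
  "sym_part A = (1/2) *\<^sub>R (A + transpose A)"

definition skew_part :: "real^'n^'n \<Rightarrow> real^'n^'n" where
  "skew_part A = (1/2) *\<^sub>R (A - transpose A)"

definition skew_matrices :: "(real^'n^'n) set" where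
  "skew_matrices = {Y. transpose Y = - Y}"

text \<open>The requirement \<open>n > p\<close> is not part of the next definition; it has to be assumed
  separately as \<open>CARD('p) < CARD('n)\<close>.\<close>

definition stiefel :: "(real^'p^'n) set" where
  "stiefel = {X. transpose X ** X = mat 1}"

definition stiefel_tangent :: "real^'p^'n \<Rightarrow> (real^'p^'n) set" where
  "stiefel_tangent X = {B. transpose X ** B + transpose B ** X = 0}"

definition stiefel_proj :: "real^'p^'n \<Rightarrow> real^'p^'n \<Rightarrow> real^'p^'n" where
  "stiefel_proj X G = G - X ** sym_part (transpose X ** G)"

definition stiefel_muon_optimal :: "real^'p^'n \<Rightarrow> real^'p^'n \<Rightarrow> real^'p^'n \<Rightarrow> bool" where
  "stiefel_muon_optimal M X B \<longleftrightarrow>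
     is_arg_min (frob_inner M) (\<lambda>B. spectral_norm B \<le> 1 \<and> B \<in> stiefel_tangent X) B"

text \<open>The feasible set consists of all \<open>n \<times> n\<close> matrices of spectral norm at most one,
  not only the skew-symmetric ones.\<close>

definition skewon_optimal :: "real^'p^'n \<Rightarrow> real^'p^'n \<Rightarrow> real^'n^'n \<Rightarrow> bool" where
  "skewon_optimal M X Y \<longleftrightarrow>
     is_arg_min (frob_inner (skew_part (M ** transpose X))) (\<lambda>Y. spectral_norm Y \<le> 1) Y"

end

theory Submission
  imports Defs
begin

text \<open>
  For skew-symmetric \<open>Y\<close> the two objectives agree, \<open>\<langle>skew (M X\<^sup>T), Y\<rangle> = \<langle>M, Y X\<rangle>\<close>, and \<open>Y X\<close> is
  feasible for the Muon problem; replacing \<open>Y\<close> by its skew part changes neither the Skewon objective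
  nor feasibility. So it suffices to extend \<open>B\<close> to a skew contraction \<open>Y\<close> with \<open>Y X = B\<close>. In a basis
  adapted to \<open>X\<close> this is a skew version of Parrott's completion problem for the block matrix
  \<open>[A, - C\<^sup>T; C, D]\<close> with \<open>A = X\<^sup>T B\<close> and \<open>C = B - X A\<close>. It is solved by \<open>D = - C A G\<close>, where
  \<open>(I + A\<^sup>2) G = C\<^sup>T\<close>; this equation is solvable even for singular \<open>I + A\<^sup>2\<close>, because
  \<open>(I + A\<^sup>2) r = 0\<close> means \<open>\<parallel>A r\<parallel> = \<parallel>r\<parallel>\<close>, and then \<open>\<parallel>A r\<parallel>\<^sup>2 + \<parallel>C r\<parallel>\<^sup>2 \<le> \<parallel>r\<parallel>\<^sup>2\<close> forces \<open>C r = 0\<close>.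
  Finally \<open>\<parallel>B\<parallel>\<^sub>2 = 1\<close>, since \<open>- P\<^sub>X(M)\<close> is a descent direction, so the optimal value is negative and a
  \<open>B\<close> of smaller norm could be scaled up.
\<close>

declare transpose_matrix_vector [simp del]

section \<open>Frobenius inner product and spectral norm\<close>

lemma frob_inner_eq_inner: "frob_inner A B = A \<bullet> B"
  unfolding frob_inner_def trace_def transpose_def matrix_matrix_mult_def inner_vec_def
  by (subst sum.swap) (simp add: inner_real_def)

lemma inner_matrix_mult_left:
  fixes A :: "real^'m^'n" and B :: "real^'k^'m" and C :: "real^'k^'n"
  shows "(A ** B) \<bullet> C = B \<bullet> (transpose A ** C)"
  unfolding frob_inner_eq_inner[symmetric] frob_inner_def
  by (simp add: matrix_transpose_mul matrix_mul_assoc)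

lemma inner_transpose_transpose:
  fixes A B :: "real^'m^'n"
  shows "transpose A \<bullet> transpose B = A \<bullet> B"
  unfolding inner_vec_def transpose_def by (subst sum.swap) simp

lemma inner_matrix_mult_right:
  fixes A :: "real^'m^'n" and B :: "real^'k^'m" and C :: "real^'k^'n"
  shows "(A ** B) \<bullet> C = A \<bullet> (C ** transpose B)"
proof -
  have "(A ** B) \<bullet> C = (transpose B ** transpose A) \<bullet> transpose C"
    by (metis inner_transpose_transpose matrix_transpose_mul)
  also have "\<dots> = transpose A \<bullet> (B ** transpose C)"
    by (simp add: inner_matrix_mult_left)
  also have "\<dots> = A \<bullet> (C ** transpose B)"
    by (metis inner_transpose_transpose matrix_transpose_mul transpose_transpose)
  finally show ?thesis .
qed

lemma inner_matrix_vector_mult: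
  fixes A :: "real^'m^'n"
  shows "(A *v x) \<bullet> y = x \<bullet> (transpose A *v y)"
  by (metis dot_lmul_matrix inner_commute transpose_matrix_vector)

lemma norm_matrix_vector_le_spectral_norm:
  "norm (A *v x) \<le> spectral_norm A * norm x"
  unfolding spectral_norm_def by (intro onorm matrix_vector_mul_bounded_linear)

lemma spectral_norm_le_iff:
  assumes "0 \<le> c"
  shows "spectral_norm A \<le> c \<longleftrightarrow> (\<forall>x. norm (A *v x) \<le> c * norm x)"
proof
  assume "spectral_norm A \<le> c"
  then show "\<forall>x. norm (A *v x) \<le> c * norm x"
    by (meson norm_matrix_vector_le_spectral_norm mult_right_mono norm_ge_zero order_trans)
qed (simp add: spectral_norm_def onorm_le)

lemma spectral_norm_nonneg: "0 \<le> spectral_norm A"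
  unfolding spectral_norm_def by (intro onorm_pos_le matrix_vector_mul_bounded_linear)

lemma spectral_norm_eq_0_iff: "spectral_norm A = 0 \<longleftrightarrow> A = 0"
proof -
  have "spectral_norm A = 0 \<longleftrightarrow> (\<forall>x. A *v x = 0)"
    unfolding spectral_norm_def by (intro onorm_eq_0 matrix_vector_mul_bounded_linear)
  then show ?thesis
    by (simp add: matrix_eq)
qed

lemma spectral_norm_scaleR: "spectral_norm (c *\<^sub>R A) = \<bar>c\<bar> * spectral_norm A"
  unfolding spectral_norm_def scaleR_matrix_vector_assoc[symmetric]
  by (intro onorm_scaleR matrix_vector_mul_bounded_linear)

lemma spectral_norm_matrix_mult: "spectral_norm (A ** B) \<le> spectral_norm A * spectral_norm B"
  unfolding spectral_norm_def
  using onorm_compose[OF matrix_vector_mul_bounded_linear[of A] matrix_vector_mul_bounded_linear[of B]]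
  by (simp add: o_def matrix_vector_mul_assoc)

text \<open>For \<open>x = transpose A *v y\<close>, adjointness and Cauchy-Schwarz bound the square
  of \<open>norm x\<close> by \<open>norm (A *v x) * norm y\<close>; one factor
  \<open>norm x\<close> then cancels.\<close>

lemma spectral_norm_transpose_le: "spectral_norm (transpose A) \<le> spectral_norm A"
proof -
  have "norm (transpose A *v y) \<le> spectral_norm A * norm y" for y
  proof -
    let ?x = "transpose A *v y"
    have "norm ?x * norm ?x = (A *v ?x) \<bullet> y"
      by (simp add: inner_matrix_vector_mult power2_norm_eq_inner flip: power2_eq_square)
    also have "\<dots> \<le> norm (A *v ?x) * norm y"
      by (rule norm_cauchy_schwarz)
    also have "\<dots> \<le> (spectral_norm A * norm ?x) * norm y"
      by (intro mult_right_mono norm_matrix_vector_le_spectral_norm norm_ge_zero)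
    finally have "norm ?x * norm ?x \<le> norm ?x * (spectral_norm A * norm y)"
      by (simp add: ac_simps)
    then show ?thesis
      by (cases "norm ?x = 0") (auto simp: spectral_norm_nonneg)
  qed
  then show ?thesis
    by (simp add: spectral_norm_le_iff spectral_norm_nonneg)
qed

lemma spectral_norm_skew_part_le: "spectral_norm (skew_part A) \<le> spectral_norm A"
proof -
  have "norm (skew_part A *v x) \<le> spectral_norm A * norm x" for x
  proof -
    have "skew_part A *v x = (1/2) *\<^sub>R (A *v x - transpose A *v x)"
      by (simp add: skew_part_def matrix_vector_mult_diff_rdistrib
          flip: scaleR_matrix_vector_assoc)
    then have "norm (skew_part A *v x) \<le> (norm (A *v x) + norm (transpose A *v x)) / 2"
      using norm_triangle_ineq4[of "A *v x" "transpose A *v x"] by simp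
    also have "\<dots> \<le> (spectral_norm A * norm x + spectral_norm A * norm x) / 2"
    proof (intro divide_right_mono add_mono)
      show "norm (transpose A *v x) \<le> spectral_norm A * norm x"
      by (meson norm_matrix_vector_le_spectral_norm spectral_norm_transpose_le mult_right_mono
          norm_ge_zero order_trans)
    qed (simp_all add: norm_matrix_vector_le_spectral_norm)
    finally show ?thesis
      by simp
  qed
  then show ?thesis
    by (simp add: spectral_norm_le_iff spectral_norm_nonneg)
qed


section \<open>Matrix algebra and linear matrix equations\<close>

lemma matrix_diff_ldistrib:
  fixes A :: "'a::ring_1^'m^'n"
  shows "A ** (B - C) = A ** B - A ** C"
  by (simp add: matrix_eq matrix_vector_mult_diff_distrib matrix_vector_mult_diff_rdistrib
      flip: matrix_vector_mul_assoc)

lemma matrix_diff_rdistrib: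
  fixes A :: "'a::ring_1^'m^'n"
  shows "(A - B) ** C = A ** C - B ** C"
  by (simp add: matrix_eq matrix_vector_mult_diff_rdistrib flip: matrix_vector_mul_assoc)

lemma transpose_add: "transpose (A + B) = transpose A + transpose B"
  by (simp add: transpose_def vec_eq_iff)

lemma transpose_diff: "transpose (A - B) = transpose A - transpose B"
  by (simp add: transpose_def vec_eq_iff)

lemma transpose_uminus: "transpose (- A) = - transpose (A :: 'a::ab_group_add^'m^'n)"
  by (simp add: transpose_def vec_eq_iff)

lemma transpose_0: "transpose 0 = 0"
  by (simp add: transpose_def vec_eq_iff)

lemma matrix_vector_mult_uminus: "(- A) *v x = - (A *v (x :: 'a::ring_1^'m))"
  by (metis diff_0 matrix_vector_mult_0 matrix_vector_mult_diff_rdistrib)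

text \<open>Fredholm alternative, column by column: the range of \<open>H\<close> is the orthogonal
  complement of the kernel of \<open>transpose H\<close>, and the assumption makes every column of
  \<open>K\<close> orthogonal to that kernel.\<close>

lemma matrix_equation_solvable:
  fixes H :: "real^'m^'k" and K :: "real^'n^'k"
  assumes "\<And>r. transpose H *v r = 0 \<Longrightarrow> transpose K *v r = 0"
  obtains G where "H ** G = K"
proof -
  have "column j K \<in> range ((*v) H)" for j
  proof -
    have adj: "adjoint ((*v) (transpose H)) = (*v) H"
      using adjoint_matrix[of "transpose H"] by simp
    have "(*v) (transpose H) -` {0} = orthogonal_comp (range ((*v) H))"
      using ker_orthogonal_comp_adjoint[of "(*v) (transpose H)"] by (simp add: adj)
    then have range: "range ((*v) H) = orthogonal_comp ((*v) (transpose H) -` {0})"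
      by (metis orthogonal_comp_self linear_subspace_image matrix_vector_mul_linear subspace_UNIV)
    have "r \<bullet> column j K = 0" if "transpose H *v r = 0" for r
    proof -
      have "r \<bullet> column j K = r \<bullet> (K *v axis j 1)"
        by (simp add: matrix_vector_mult_basis)
      also have "\<dots> = (transpose K *v r) \<bullet> axis j 1"
        by (simp add: inner_matrix_vector_mult)
      finally show ?thesis
        using assms[OF that] by simp
    qed
    then show ?thesis
      by (simp add: range orthogonal_comp_def orthogonal_def)
  qed
  then have "\<forall>j. \<exists>g. H *v g = column j K"
    by (metis imageE)
  then obtain g where g: "H *v g j = column j K" for j
    by metis
  have "H ** (\<chi> i j. g j $ i) = K"
  proof -
    have "(H *v g j) $ i = K $ i $ j" for i j
      by (simp add: g column_def)
    then show ?thesis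
      by (simp add: vec_eq_iff matrix_matrix_mult_def matrix_vector_mult_def)
  qed
  then show thesis
    by (rule that)
qed

section \<open>Skew matrices and Stiefel geometry\<close>

lemma skew_inner:
  assumes "transpose A = - (A :: real^'n^'n)"
  shows "(A *v x) \<bullet> y = - (x \<bullet> (A *v y))"
  by (simp add: inner_matrix_vector_mult assms matrix_vector_mult_uminus)

lemma stiefel_inner:
  assumes "X \<in> stiefel"
  shows "(X *v a) \<bullet> (X *v b) = a \<bullet> b"
  using assms by (simp add: stiefel_def inner_matrix_vector_mult matrix_vector_mul_assoc)

lemma stiefel_tangent_iff_skew:
  "B \<in> stiefel_tangent X \<longleftrightarrow> transpose (transpose X ** B) = - (transpose X ** B)"
  by (simp add: stiefel_tangent_def matrix_transpose_mul eq_neg_iff_add_eq_0 add.commute)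

lemma spectral_norm_stiefel_le:
  assumes "X \<in> stiefel"
  shows "spectral_norm X \<le> 1"
  by (simp add: spectral_norm_le_iff norm_eq_sqrt_inner stiefel_inner[OF assms])

lemma skew_part_in_skew_matrices: "skew_part A \<in> skew_matrices"
  by (simp add: skew_matrices_def skew_part_def transpose_scalar transpose_diff flip: scaleR_minus_right)

section \<open>Contractive skew completion\<close>

lemma skew_completion:
  assumes X: "X \<in> stiefel" and B: "B \<in> stiefel_tangent X" and B_le: "spectral_norm B \<le> 1"
  obtains Y where "Y \<in> skew_matrices" "Y ** X = B" "spectral_norm Y \<le> 1"
proof -
  define A where "A = transpose X ** B"
  define C where "C = B - X ** A"
  define H where "H = mat 1 + A ** A"
  have XX: "transpose X ** X = mat 1"
    using X by (simp add: stiefel_def)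
  have A: "transpose A = - A"
    using B by (simp add: stiefel_tangent_iff_skew A_def)
  have XC: "transpose X ** C = 0"
    by (simp add: C_def matrix_diff_ldistrib matrix_mul_assoc XX A_def)
  have CX: "transpose C ** X = 0"
    using arg_cong[OF XC, of transpose] by (simp add: matrix_transpose_mul transpose_0)
  have XC_inner: "(X *v a) \<bullet> (C *v b) = 0" for a b
    by (simp add: inner_matrix_vector_mult matrix_vector_mul_assoc XC)
  then have CX_inner: "(C *v b) \<bullet> (X *v a) = 0" for a b
    by (metis inner_commute)
  have pythagoras: "(norm (X *v a + C *v b))\<^sup>2 = (norm a)\<^sup>2 + (norm (C *v b))\<^sup>2" for a b
    by (simp add: power2_norm_eq_inner inner_add_left inner_add_right stiefel_inner[OF X] XC_inner
        CX_inner)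
  have contraction: "(norm (A *v z))\<^sup>2 + (norm (C *v z))\<^sup>2 \<le> (norm z)\<^sup>2" for z
  proof -
    have "B *v z = X *v (A *v z) + C *v z"
      by (simp add: C_def matrix_vector_mult_diff_rdistrib matrix_vector_mul_assoc)
    then have "(norm (A *v z))\<^sup>2 + (norm (C *v z))\<^sup>2 = (norm (B *v z))\<^sup>2"
      by (simp add: pythagoras)
    also have "\<dots> \<le> (norm z)\<^sup>2"
      using B_le by (intro power_mono) (auto simp: spectral_norm_le_iff)
    finally show ?thesis .
  qed
  have AA: "(A *v (A *v z)) \<bullet> z = - (norm (A *v z))\<^sup>2" for z
    by (simp add: skew_inner[OF A] power2_norm_eq_inner)
  have H_apply: "H *v z = z + A *v (A *v z)" for z
    by (simp add: H_def matrix_vector_mult_add_rdistrib matrix_vector_mul_assoc)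
  \<comment> \<open>By \<open>contraction\<close> this quadratic form dominates the square of
    \<open>norm (C *v z)\<close>. This settles the kernel condition for \<open>H\<close> and, later,
    the lower bound on \<open>s\<close>.\<close>
  have H_inner: "(H *v z) \<bullet> z = (norm z)\<^sup>2 - (norm (A *v z))\<^sup>2" for z
    by (simp add: H_apply inner_add_left AA power2_norm_eq_inner[of z])
  have "transpose H = H"
  proof -
    have "(H *v x) \<bullet> y = x \<bullet> (H *v y)" for x y
      by (simp add: H_apply inner_add_left inner_add_right skew_inner[OF A])
    then have "x \<bullet> (transpose H *v y) = x \<bullet> (H *v y)" for x y
      by (simp flip: inner_matrix_vector_mult)
    then show ?thesis
      by (metis matrix_eq vector_eq_ldot)
  qed
  have "transpose (transpose C) *v r = 0" if "transpose H *v r = 0" for r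
  proof -
    have "(norm r)\<^sup>2 = (norm (A *v r))\<^sup>2"
      using H_inner[of r] that \<open>transpose H = H\<close> by simp
    then show ?thesis
      using contraction[of r] by simp
  qed
  then obtain G0 where G0: "H ** G0 = transpose C"
    using matrix_equation_solvable by metis
  \<comment> \<open>Making \<open>G\<close> vanish on the range of \<open>X\<close> is what gives \<open>Y X = B\<close>; the completion \<open>Y\<close> is not yet
    skew, but \<open>X\<^sup>T Y = - B\<^sup>T\<close> lets its skew part inherit \<open>Y X = B\<close>.\<close>
  define G where "G = G0 - G0 ** X ** transpose X"
  have HG: "H ** G = transpose C"
    by (simp add: G_def matrix_diff_ldistrib matrix_mul_assoc G0 CX)
  have GX: "G ** X = 0"
    by (simp add: G_def matrix_diff_rdistrib XX flip: matrix_mul_assoc)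
  \<comment> \<open>Relative to the range of \<open>X\<close> and its complement,
    \<open>B ** transpose X\<close> is the first block column, \<open>- X ** transpose C\<close> the
    upper right block and \<open>- C ** A ** G\<close> the lower right block.\<close>
  define Y where "Y = B ** transpose X - X ** transpose C - C ** A ** G"
  have YX: "Y ** X = B"
    by (simp add: Y_def matrix_diff_rdistrib XX CX GX flip: matrix_mul_assoc)
  have XY: "transpose X ** Y = - transpose B"
  proof -
    have "transpose X ** Y = A ** transpose X - transpose C"
      by (simp add: Y_def matrix_diff_ldistrib matrix_mul_assoc XX XC flip: A_def)
    also have "\<dots> = transpose (X ** transpose A - C)"
      by (simp add: transpose_diff matrix_transpose_mul)
    also have "X ** transpose A - C = - B"
      by (simp add: A C_def matrix_diff_ldistrib[of X 0, simplified])
    finally show ?thesis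
      by (simp add: transpose_uminus)
  qed
  have "norm (Y *v w) \<le> norm w" for w
  proof -
    \<comment> \<open>The vector \<open>w\<close> splits orthogonally into \<open>X *v u\<close> and
      \<open>v\<close>. The shift in \<open>z\<close> collects the terms of \<open>Y *v w\<close>
      into \<open>X *v (A *v z - q) + C *v z\<close>, so that |w|^2 - |Y w|^2 is the sum of |z|^2 -
      |A z|^2 - |C z|^2 and |v|^2 - |q|^2 + |A q|^2. The first is nonnegative by
      \<open>contraction\<close>.\<close>
    define u where "u = transpose X *v w"
    define v where "v = w - X *v u"
    define q where "q = G *v w"
    define z where "z = u - A *v q"
    have Cw: "transpose C *v w = q + A *v (A *v q)"
      by (metis HG H_apply matrix_vector_mul_assoc q_def)
    have "transpose X *v v = 0"
      by (simp add: v_def u_def matrix_vector_mult_diff_distrib matrix_vector_mul_assoc matrix_mul_assoc XX)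
    then have "(norm w)\<^sup>2 = (norm u)\<^sup>2 + (norm v)\<^sup>2"
    proof -
      have "w = X *v u + v" "(X *v u) \<bullet> v = 0"
        using \<open>transpose X *v v = 0\<close> by (simp_all add: v_def inner_matrix_vector_mult)
      then show ?thesis
        by (metis norm_add_Pythagorean orthogonal_def power2_norm_eq_inner stiefel_inner[OF X])
    qed
    moreover have "Y *v w = X *v (A *v z - q) + C *v z"
    proof -
      have "Y *v w = B *v u - X *v (transpose C *v w) - C *v (A *v q)"
        by (simp add: Y_def matrix_vector_mult_diff_rdistrib u_def q_def
            matrix_vector_mul_assoc matrix_mul_assoc)
      also have "B *v u = X *v (A *v u) + C *v u"
        by (simp add: C_def matrix_vector_mult_diff_rdistrib matrix_vector_mul_assoc)
      finally show ?thesis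
        by (simp add: Cw z_def algebra_simps)
    qed
    then have "(norm (Y *v w))\<^sup>2 = (norm (A *v z - q))\<^sup>2 + (norm (C *v z))\<^sup>2"
      by (simp add: pythagoras)
    moreover have "(norm (A *v z - q))\<^sup>2 = (norm (A *v z))\<^sup>2 + 2 * (z \<bullet> (A *v q)) + (norm q)\<^sup>2"
      by (simp add: power2_norm_eq_inner inner_diff_left inner_diff_right skew_inner[OF A, of z]
          inner_commute[of q "A *v z"])
    moreover have "(norm z)\<^sup>2 + 2 * (z \<bullet> (A *v q)) = (norm u)\<^sup>2 - (norm (A *v q))\<^sup>2"
      by (simp add: z_def power2_norm_eq_inner inner_diff_left inner_diff_right
          inner_commute[of "A *v q" u])
    \<comment> \<open>The left side \<open>s\<close> equals \<open>v \<bullet> (C *v q)\<close>,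
      hence is at most |v| |C q|, and it is at least |C q|^2. So |C q| is at most |v|, and
      \<open>s\<close> is at most |v|^2.\<close>
    moreover have "(norm q)\<^sup>2 - (norm (A *v q))\<^sup>2 \<le> (norm v)\<^sup>2"
    proof -
      define s where "s = (norm q)\<^sup>2 - (norm (A *v q))\<^sup>2"
      have "s = (transpose C *v w) \<bullet> q"
        using H_inner[of q] by (simp add: s_def Cw H_apply)
      also have "\<dots> = w \<bullet> (C *v q)"
        by (simp add: inner_matrix_vector_mult)
      also have "\<dots> = v \<bullet> (C *v q)"
        by (simp add: v_def inner_diff_left XC_inner)
      also have "\<dots> \<le> norm v * norm (C *v q)"
        by (rule norm_cauchy_schwarz)
      finally have s: "s \<le> norm v * norm (C *v q)" .
      have "(norm (C *v q))\<^sup>2 \<le> s"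
        using contraction[of q] by (simp add: s_def)
      with s have "norm (C *v q) \<le> norm v"
        by (metis linorder_not_le mult_less_cancel_right norm_ge_zero not_less_iff_gr_or_eq order_trans power2_eq_square)
      then have "norm v * norm (C *v q) \<le> (norm v)\<^sup>2"
        by (simp add: power2_eq_square mult_left_mono)
      with s show ?thesis
        by (simp add: s_def)
    qed
    ultimately have "(norm (Y *v w))\<^sup>2 \<le> (norm w)\<^sup>2"
      using contraction[of z] by linarith
    then show ?thesis
      by simp
  qed
  then have "spectral_norm Y \<le> 1"
    by (simp add: spectral_norm_le_iff)
  then have "spectral_norm (skew_part Y) \<le> 1"
    using spectral_norm_skew_part_le order_trans by blast
  moreover have "skew_part Y ** X = B"
  proof -
    have "transpose Y ** X = - B"
      using arg_cong[OF XY, of transpose] by (simp add: matrix_transpose_mul transpose_uminus)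
    then show ?thesis
      by (simp add: skew_part_def YX matrix_diff_rdistrib flip: scalar_matrix_assoc scaleR_2)
  qed
  ultimately show thesis
    using that skew_part_in_skew_matrices by blast
qed

section \<open>Transfer of the objective and the tangent projection\<close>

text \<open>Taking the skew part is an orthogonal projection, hence self-adjoint.\<close>

lemma inner_skew_part_commute: "skew_part A \<bullet> B = A \<bullet> skew_part B"
  using inner_transpose_transpose[of A "transpose B"]
  by (simp add: skew_part_def inner_diff_left inner_diff_right)

lemma inner_mult_transpose_skew:
  fixes M X :: "real^'p^'n"
  shows "skew_part (M ** transpose X) \<bullet> Y = M \<bullet> (skew_part Y ** X)"
  by (simp add: inner_skew_part_commute inner_matrix_mult_right)

text \<open>The congruence \<open>transpose X ** Y ** X\<close> inherits skewness from
  \<open>Y\<close>.\<close>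

lemma skew_mult_in_tangent:
  assumes "Y \<in> skew_matrices"
  shows "Y ** X \<in> stiefel_tangent X"
  using assms unfolding stiefel_tangent_iff_skew skew_matrices_def
  by (simp add: matrix_transpose_mul matrix_mul_assoc matrix_eq matrix_vector_mult_uminus
      matrix_vector_mult_diff_distrib[of _ 0, simplified] flip: matrix_vector_mul_assoc)

lemma stiefel_proj_in_tangent:
  assumes "X \<in> stiefel"
  shows "stiefel_proj X M \<in> stiefel_tangent X"
proof -
  have "transpose X ** stiefel_proj X M = skew_part (transpose X ** M)"
    using assms
    by (simp add: stiefel_proj_def matrix_diff_ldistrib matrix_mul_assoc stiefel_def sym_part_def skew_part_def)
       (simp add: vec_eq_iff field_simps)
  then show ?thesis
    using skew_part_in_skew_matrices[of "transpose X ** M"]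
    by (simp add: stiefel_tangent_iff_skew skew_matrices_def)
qed

text \<open>Transposing both factors preserves the inner product but flips its sign.\<close>

lemma inner_sym_skew:
  fixes S A :: "real^'n^'n"
  assumes "transpose S = S" "transpose A = - A"
  shows "S \<bullet> A = 0"
  using inner_transpose_transpose[of S A] assms by simp

text \<open>The component of \<open>M\<close> removed by the projection is \<open>X\<close> times a
  symmetric matrix. Moving \<open>X\<close> across the inner product pairs that matrix with the skew
  matrix \<open>transpose X ** B\<close>, which gives zero.\<close>

lemma inner_stiefel_proj:
  assumes "X \<in> stiefel" "B \<in> stiefel_tangent X"
  shows "M \<bullet> B = stiefel_proj X M \<bullet> B"
proof -
  have "(X ** sym_part (transpose X ** M)) \<bullet> B = sym_part (transpose X ** M) \<bullet> (transpose X ** B)"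
    by (rule inner_matrix_mult_left)
  also have "\<dots> = 0"
    using assms(2) by (intro inner_sym_skew)
      (simp_all add: sym_part_def transpose_scalar transpose_add add.commute stiefel_tangent_iff_skew)
  finally show ?thesis
    by (simp add: stiefel_proj_def inner_diff_left)
qed

lemma stiefel_tangent_scaleR:
  assumes "B \<in> stiefel_tangent X"
  shows "c *\<^sub>R B \<in> stiefel_tangent X"
  using assms unfolding stiefel_tangent_iff_skew
  by (simp add: transpose_scalar matrix_scalar_ac flip: scalar_matrix_assoc)

section \<open>Optimality and attained norms\<close>

lemma muon_optimal_iff:
  "stiefel_muon_optimal M X B \<longleftrightarrow> spectral_norm B \<le> 1 \<and> B \<in> stiefel_tangent X \<and>
     (\<forall>B'. spectral_norm B' \<le> 1 \<and> B' \<in> stiefel_tangent X \<longrightarrow> M \<bullet> B \<le> M \<bullet> B')"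
  by (auto simp: stiefel_muon_optimal_def is_arg_min_linorder frob_inner_eq_inner)

lemma skewon_optimal_iff:
  "skewon_optimal M X Y \<longleftrightarrow> spectral_norm Y \<le> 1 \<and>
     (\<forall>Y'. spectral_norm Y' \<le> 1 \<longrightarrow>
        skew_part (M ** transpose X) \<bullet> Y \<le> skew_part (M ** transpose X) \<bullet> Y')"
  by (auto simp: skewon_optimal_def is_arg_min_linorder frob_inner_eq_inner)

lemma spectral_norm_muon_optimal:
  assumes X: "X \<in> stiefel" and "stiefel_proj X M \<noteq> 0" and opt: "stiefel_muon_optimal M X B"
  shows "spectral_norm B = 1"
proof -
  define P where "P = stiefel_proj X M"
  \<comment> \<open>The factor scales the descent direction \<open>- P\<close> to spectral norm
    one.\<close>
  define c where "c = - inverse (spectral_norm P)"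
  have "P \<noteq> 0"
    using assms by (simp add: P_def)
  then have pos: "0 < spectral_norm P"
    using spectral_norm_nonneg[of P] spectral_norm_eq_0_iff[of P] by linarith
  have P: "P \<in> stiefel_tangent X"
    using X by (simp add: P_def stiefel_proj_in_tangent)
  have "spectral_norm (c *\<^sub>R P) \<le> 1"
    using pos unfolding spectral_norm_scaleR c_def by simp
  then have "M \<bullet> B \<le> M \<bullet> (c *\<^sub>R P)"
    using opt P stiefel_tangent_scaleR muon_optimal_iff by blast
  also have "\<dots> = c * (P \<bullet> P)"
    using inner_stiefel_proj[OF X P, of M] by (simp add: P_def)
  also have "\<dots> < 0"
    using pos \<open>P \<noteq> 0\<close> by (simp add: c_def)
  finally have neg: "M \<bullet> B < 0" .
  then have "B \<noteq> 0"
    by auto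
  then have Bpos: "0 < spectral_norm B"
    using spectral_norm_nonneg[of B] spectral_norm_eq_0_iff[of B] by linarith
  let ?t = "inverse (spectral_norm B)"
  have "spectral_norm (?t *\<^sub>R B) \<le> 1"
    using Bpos by (simp add: spectral_norm_scaleR)
  then have "M \<bullet> B \<le> ?t * (M \<bullet> B)"
    using opt by (simp add: muon_optimal_iff stiefel_tangent_scaleR flip: inner_scaleR_right)
  \<comment> \<open>The objective at \<open>B\<close> is negative, so a factor above one would lower
    it strictly.\<close>
  then have "?t \<le> 1"
    using neg by (simp add: mult_le_cancel_right1)
  then have "1 \<le> spectral_norm B"
    using Bpos by (simp add: field_simps)
  then show ?thesis
    using opt by (simp add: muon_optimal_iff)
qed

theorem theorem2:
  fixes M X B :: "real^'p^'n"
  assumes "CARD('p) < CARD('n)"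
    and "X \<in> stiefel"
    and "stiefel_proj X M \<noteq> 0"
    and "stiefel_muon_optimal M X B"
  shows "\<exists>Y \<in> skew_matrices.
           skewon_optimal M X Y \<and>
           Y ** X = B \<and>
           spectral_norm Y = 1 \<and> spectral_norm B = 1 \<and>
           frob_inner M B = frob_inner (skew_part (M ** transpose X)) Y"
proof -
  note X = assms(2) and opt = assms(4)
  have B1: "spectral_norm B = 1"
    using assms by (intro spectral_norm_muon_optimal)
  obtain Y where Y: "Y \<in> skew_matrices" "Y ** X = B" "spectral_norm Y \<le> 1"
    using skew_completion X opt muon_optimal_iff by blast
  have "skew_part Y = Y"
    using Y(1) by (simp add: skew_part_def skew_matrices_def flip: scaleR_2)
  then have objective: "skew_part (M ** transpose X) \<bullet> Y = M \<bullet> B"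
    by (simp add: inner_mult_transpose_skew Y(2))
  \<comment> \<open>Since \<open>X\<close> is a contraction, \<open>Y\<close> cannot have smaller
    norm than \<open>Y ** X = B\<close>.\<close>
  have "1 \<le> spectral_norm Y * spectral_norm X"
    using spectral_norm_matrix_mult[of Y X] by (simp add: Y(2) B1)
  also have "\<dots> \<le> spectral_norm Y"
    using spectral_norm_stiefel_le[OF X] by (simp add: mult_left_le spectral_norm_nonneg)
  finally have Y1: "spectral_norm Y = 1"
    using Y(3) by simp
  \<comment> \<open>Each competitor \<open>Y'\<close> yields the Muon-feasible matrix
    \<open>skew_part Y' ** X\<close> with the same objective value.\<close>
  have "M \<bullet> B \<le> skew_part (M ** transpose X) \<bullet> Y'" if "spectral_norm Y' \<le> 1" for Y'
  proof -
    have "spectral_norm (skew_part Y' ** X) \<le> spectral_norm (skew_part Y') * spectral_norm X"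
      by (rule spectral_norm_matrix_mult)
    also have "\<dots> \<le> 1"
      using that spectral_norm_skew_part_le[of Y'] spectral_norm_stiefel_le[OF X]
      by (intro mult_le_one spectral_norm_nonneg) auto
    finally show ?thesis
      using opt by (simp add: inner_mult_transpose_skew muon_optimal_iff skew_mult_in_tangent
          skew_part_in_skew_matrices)
  qed
  then have "skewon_optimal M X Y"
    by (simp add: skewon_optimal_iff Y(3) objective)
  then show ?thesis
    using Y B1 Y1 objective by (auto simp: frob_inner_eq_inner)
qed

end
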